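(* Let $\triangle\subset\mathbb C$ be the open unit disk, let $\Gamma\subset\partial\triangle$ be an open interval (open arc of the unit circle), and let $U\subset\mathbb C$ be an open neighbourhood of $\overline\Gamma$. Suppose that $\{D_j\}_{j=1}^\infty$ is a sequence of simply connected domains in $\mathbb C$ such that each $D_j$ contains $\triangle$, each $D_j$ is bounded by a closed Jordan curve, all $D_j$ are contained in the disk $\triangle_R(0)$ for some fixed $R>0$ (independent of $j$), and $D_j\cap U=\triangle\cap U$ for all $j$. Assume further that $D_j\rightarrow\triangle$ with respect to kernel convergence. For each $j$ let $f_j:D_j\rightarrow\triangle$ be the Riemann map with $f_j(0)=0$ and $f_j'(0)>0$, extended continuously to $\overline{D_j}$. Then $f_j\rightarrow\mathrm{id}$ uniformly on compact subsets of $\triangle\cup\Gamma$.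
   Context: $\triangle_r(z_0)=\{z\in\mathbb C:|z-z_0|<r\}$ and $\triangle=\triangle_1(0)$. A Riemann map $f:D\to\triangle$ is a biholomorphic map of $D$ onto $\triangle$. Since each $D_j$ is bounded by a Jordan curve, $f_j$ extends to a homeomorphism $\overline{D_j}\to\overline{\triangle}$ (Carathéodory), and the extension is still denoted $f_j$; the hypothesis $D_j\cap U=\triangle\cap U$ gives $\Gamma\subset\partial D_j$, so $f_j$ is defined on $\triangle\cup\Gamma$. Kernel convergence is in the sense of Carathéodory, with respect to the point $0$: for a sequence of domains $D_j$ all containing a fixed neighbourhood of $0$, the kernel is the largest domain $G$ containing $0$ such that every compact subset of $G$ is contained in $D_j$ for all sufficiently large $j$; $D_j\to G$ with respect to kernel convergence means that every subsequence of $\{D_j\}$ has the same kernel $G$. *)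

theory Defs
  imports "HOL-Complex_Analysis.Complex_Analysis"
begin

definition domain_in_plane :: "complex set \<Rightarrow> bool" where
  "domain_in_plane D \<longleftrightarrow> open D \<and> connected D \<and> D \<noteq> {}"

(* An open interval of the unit circle: nonempty, and never the whole circle
   (for b = a + 2 * pi it is the circle without one point). *)
definition open_circle_arc :: "complex set \<Rightarrow> bool" where
  "open_circle_arc \<Gamma> \<longleftrightarrow> (\<exists>a b. a < b \<and> b \<le> a + 2 * pi \<and> \<Gamma> = cis ` {a<..<b})"

definition bounded_by_Jordan_curve :: "complex set \<Rightarrow> bool" where
  "bounded_by_Jordan_curve D \<longleftrightarrow>
     (\<exists>c. simple_path c \<and> pathfinish c = pathstart c \<and> frontier D = path_image c)"

definition biholomorphic_map :: "complex set \<Rightarrow> complex set \<Rightarrow> (complex \<Rightarrow> complex) \<Rightarrow> bool" where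
  "biholomorphic_map A B f \<longleftrightarrow>
     f holomorphic_on A \<and> bij_betw f A B \<and> inv_into A f holomorphic_on B"

abbreviation Riemann_map :: "complex set \<Rightarrow> (complex \<Rightarrow> complex) \<Rightarrow> bool" where
  "Riemann_map D f \<equiv> biholomorphic_map D (ball 0 1) f"

definition kernel_admissible :: "complex \<Rightarrow> (nat \<Rightarrow> complex set) \<Rightarrow> complex set \<Rightarrow> bool" where
  "kernel_admissible p D G \<longleftrightarrow> domain_in_plane G \<and> p \<in> G \<and>
     (\<forall>K. compact K \<and> K \<subseteq> G \<longrightarrow> (\<forall>\<^sub>F j in sequentially. K \<subseteq> D j))"

(* The Caratheodory kernel with respect to p, as a relation. It is meant for sequences
   of domains containing a common neighbourhood of p. *)
definition is_kernel :: "complex \<Rightarrow> (nat \<Rightarrow> complex set) \<Rightarrow> complex set \<Rightarrow> bool" where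
  "is_kernel p D G \<longleftrightarrow>
     kernel_admissible p D G \<and> (\<forall>H. kernel_admissible p D H \<longrightarrow> H \<subseteq> G)"

definition kernel_converges :: "complex \<Rightarrow> (nat \<Rightarrow> complex set) \<Rightarrow> complex set \<Rightarrow> bool" where
  "kernel_converges p D G \<longleftrightarrow>
     (\<forall>r :: nat \<Rightarrow> nat. strict_mono r \<longrightarrow> is_kernel p (D \<circ> r) G)"

end

theory Submission
  imports Defs
begin

text \<open>
  The inverse maps \<open>g\<^sub>j\<close> of the \<open>f\<^sub>j\<close> are bounded by \<open>R\<close>, so they form a normal family. By Hurwitz the
  image of a subsequential limit \<open>G\<close> is contained in the kernel, i.e. in the unit disc. If \<open>h\<close> is a
  subsequential limit of the \<open>f\<^sub>j\<close>, then \<open>G \<circ> h = id\<close> and Schwarz' lemma for both \<open>G\<close> and \<open>h\<close> makes \<open>h\<close> a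
  rotation, which is the identity because \<open>f\<^sub>j'(0) > 0\<close>; hence \<open>f\<^sub>j \<rightarrow> id\<close> on the disc.

  On the arc \<open>|f\<^sub>j| = 1\<close>, so \<open>f\<^sub>j (exp (i z))\<close> extends by reflection across the real axis.
  Schwarz' lemma for \<open>g\<^sub>j\<close> gives \<open>|z| \<le> R |f\<^sub>j z|\<close>, which bounds the reflected functions independently
  of \<open>j\<close>. They form a normal family again, and by the identity theorem their only
  subsequential limit is \<open>exp (i z)\<close>.
\<close>

section \<open>Normal families: Montel and Hurwitz\<close>

text \<open>By Montel, a subsequence that fails to be \<open>e\<close>-close to \<open>g\<close> on
  \<open>K\<close> has a further subsequence converging on compact sets, and \<open>uniq\<close>
  identifies its limit with \<open>g\<close>: a contradiction. Used twice, for the maps on the disc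
  and for their reflected extensions.\<close>

lemma uniform_limit_if_unique_subsequential_limit:
  fixes F :: "nat \<Rightarrow> complex \<Rightarrow> complex"
  assumes S: "open S"
    and hol: "\<And>n. F n holomorphic_on S"
    and bnd: "\<And>n z. z \<in> S \<Longrightarrow> norm (F n z) \<le> B"
    and uniq: "\<And>h r z. \<lbrakk>strict_mono r; h holomorphic_on S;
        \<And>K. \<lbrakk>compact K; K \<subseteq> S\<rbrakk> \<Longrightarrow> uniform_limit K (\<lambda>n. F (r n)) h sequentially; z \<in> S\<rbrakk>
        \<Longrightarrow> h z = g z"
    and K: "compact K" "K \<subseteq> S"
  shows "uniform_limit K F g sequentially"
proof (rule uniform_limitI, rule ccontr)
  fix e :: real
  assume "e > 0" and "\<not> (\<forall>\<^sub>F n in sequentially. \<forall>z\<in>K. dist (F n z) (g z) < e)"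
  then obtain r :: "nat \<Rightarrow> nat" where r: "strict_mono r" "\<And>n. \<not> (\<forall>z\<in>K. dist (F (r n) z) (g z) < e)"
    using not_eventually_sequentiallyD by blast
  obtain h s where h: "h holomorphic_on S" "strict_mono (s :: nat \<Rightarrow> nat)"
    "\<And>L. \<lbrakk>compact L; L \<subseteq> S\<rbrakk> \<Longrightarrow> uniform_limit L ((\<lambda>n. F (r n)) \<circ> s) h sequentially"
    by (rule Montel [of S "range F" "\<lambda>n. F (r n)"]) (use S hol bnd in blast)+
  have "h z = g z" if "z \<in> K" for z
    by (rule uniq [of "r \<circ> s"]) (use h r K that strict_mono_o [OF r(1) h(2)] in \<open>auto simp: o_def\<close>)
  then have "\<forall>\<^sub>F n in sequentially. \<forall>z\<in>K. dist (F (r (s n)) z) (g z) < e"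
    using uniform_limitD [OF h(3) [OF K] \<open>e > 0\<close>] by simp
  then show False
    using r(2) by (auto simp: eventually_sequentially)
qed

text \<open>If images kept missing points \<open>w n\<close> of \<open>K\<close>, a subsequence of
  these would tend to some \<open>l\<close> in the image of \<open>g\<close>. The zero-free
  functions \<open>F n - w n\<close> would then converge to \<open>g - l\<close>, which is not
  constant but has a zero, contrary to Hurwitz.\<close>

lemma compact_eventually_subset_image:
  assumes S: "open S" "connected S"
    and hol: "\<And>n. F n holomorphic_on S" "g holomorphic_on S"
    and lim: "\<And>L. \<lbrakk>compact L; L \<subseteq> S\<rbrakk> \<Longrightarrow> uniform_limit L F g sequentially"
    and nonconst: "\<not> g constant_on S"
    and K: "compact K" "K \<subseteq> g ` S"
  shows "\<forall>\<^sub>F n in sequentially. K \<subseteq> F n ` S"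
proof (rule ccontr)
  assume "\<not> (\<forall>\<^sub>F n in sequentially. K \<subseteq> F n ` S)"
  then obtain r :: "nat \<Rightarrow> nat" where r: "strict_mono r" "\<And>n. \<not> K \<subseteq> F (r n) ` S"
    using not_eventually_sequentiallyD by blast
  then have "\<forall>n. \<exists>w. w \<in> K \<and> w \<notin> F (r n) ` S"
    by blast
  then obtain w where w: "\<And>n. w n \<in> K" "\<And>n. w n \<notin> F (r n) ` S"
    by metis
  obtain l s where l: "l \<in> K" "strict_mono (s :: nat \<Rightarrow> nat)" "(w \<circ> s) \<longlonglongrightarrow> l"
    using K(1) w(1) unfolding compact_def by metis
  obtain z where z: "z \<in> S" "g z = l"
    using K(2) l(1) by blast
  have fl: "filterlim (r \<circ> s) sequentially sequentially"
    using r(1) l(2) by (simp add: filterlim_subseq strict_mono_o)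
  have "g z - l \<noteq> 0"
  proof (rule Hurwitz_no_zeros [of S "\<lambda>n z. F (r (s n)) z - w (s n)" "\<lambda>z. g z - l"])
    show "uniform_limit L (\<lambda>n z. F (r (s n)) z - w (s n)) (\<lambda>z. g z - l) sequentially"
      if "compact L" "L \<subseteq> S" for L
    proof (intro uniform_limit_intros)
      show "uniform_limit L (\<lambda>n. F (r (s n))) g sequentially"
        using filterlim_compose [OF lim [OF that] fl] by (simp add: o_def)
      show "uniform_limit L (\<lambda>n x. w (s n)) (\<lambda>x. l) sequentially"
        using l(3) by (auto simp: uniform_limit_iff tendsto_iff o_def)
    qed
    show "\<not> (\<lambda>z. g z - l) constant_on S"
      using nonconst by (simp add: constant_on_def algebra_simps)
    show "F (r (s n)) x - w (s n) \<noteq> 0" if "x \<in> S" for n x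
      using w(2) [of "s n"] that by force
  qed (use S z in \<open>auto intro!: holomorphic_intros hol\<close>)
  with z show False by simp
qed

section \<open>Boundary values and Schwarz reflection across an arc\<close>

text \<open>If \<open>f z\<close> were in the open disc, continuity of the inverse there would make
  the points \<open>x n = g (f (x n))\<close> tend to a point of \<open>D\<close>, while they tend
  to \<open>z\<close> outside \<open>D\<close>.\<close>

lemma norm_eq_1_on_frontier:
  assumes D: "open D"
    and f: "biholomorphic_map D (ball 0 1) f" "continuous_on (closure D) f"
    and z: "z \<in> closure D" "z \<notin> D"
  shows "norm (f z) = 1"
proof -
  define g where "g = inv_into D f"
  have bij: "bij_betw f D (ball 0 1)" and holg: "g holomorphic_on ball 0 1"
    using f(1) by (auto simp: biholomorphic_map_def g_def)
  obtain x where x: "\<And>n. x n \<in> D" "x \<longlonglongrightarrow> z"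
    using z(1) closure_sequential by blast
  have fx: "(\<lambda>n. f (x n)) \<longlonglongrightarrow> f z"
    by (rule continuous_on_tendsto_compose [OF f(2) x(2) z(1)])
       (use x(1) closure_subset in \<open>auto intro!: always_eventually\<close>)
  have in1: "f (x n) \<in> ball 0 1" for n
    using bij x(1) bij_betwE by blast
  have le: "norm (f z) \<le> 1"
    by (rule LIMSEQ_le_const2 [OF tendsto_norm [OF fx]])
       (use in1 in \<open>auto intro!: less_imp_le\<close>)
  have False if "norm (f z) < 1"
  proof -
    have "(\<lambda>n. g (f (x n))) \<longlonglongrightarrow> g (f z)"
      by (intro continuous_on_tendsto_compose [OF holomorphic_on_imp_continuous_on [OF holg] fx])
         (use that in1 in auto)
    moreover have "g (f (x n)) = x n" for n
      using bij x(1) by (simp add: g_def bij_betw_inv_into_left)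
    ultimately have "g (f z) = z"
      using x(2) LIMSEQ_unique by simp
    moreover have "g (f z) \<in> D"
      using that bij bij_betw_inv_into [OF bij] unfolding g_def
      by (metis bij_betwE mem_ball_0)
    ultimately show False using z(2) by simp
  qed
  with le show ?thesis by force
qed

text \<open>Schwarz reflection in the coordinate \<open>z\<close> of \<open>exp (\<i> * z)\<close>,
  which maps the upper half of the strip into the punctured disc and the real segment onto the arc.
  Reflection of the argument in the circle becomes \<open>cnj\<close>; the values are reflected in
  the circle by \<open>inverse\<close> and \<open>cnj\<close>. Since \<open>exp\<close> never
  vanishes, a zero of \<open>\<phi>\<close> at 0 does no harm.\<close>

lemma holomorphic_circle_reflection:
  fixes \<phi> :: "complex \<Rightarrow> complex"
  assumes hol: "\<phi> holomorphic_on ball 0 1"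
    and cont: "continuous_on (ball 0 1 \<union> cis ` {a<..<b}) \<phi>"
    and nz: "\<And>z. \<lbrakk>z \<in> ball 0 1; z \<noteq> 0\<rbrakk> \<Longrightarrow> \<phi> z \<noteq> 0"
    and unit: "\<And>t. t \<in> {a<..<b} \<Longrightarrow> norm (\<phi> (cis t)) = 1"
  shows "(\<lambda>z. if 0 \<le> Im z then \<phi> (exp (\<i> * z)) else inverse (cnj (\<phi> (exp (\<i> * cnj z)))))
           holomorphic_on {z. a < Re z \<and> Re z < b}" (is "?H holomorphic_on ?S")
proof -
  define p where "p z = \<phi> (exp (\<i> * z))" for z
  have S: "open ?S"
    by (intro open_Collect_conj open_Collect_less continuous_intros)
  have E: "exp (\<i> * z) \<in> ball 0 1" if "0 < Im z" for z
    using that by simp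
  have E0: "exp (\<i> * z) \<in> ball 0 1 \<union> cis ` {a<..<b}" if "z \<in> ?S" "0 \<le> Im z" for z
  proof (cases "Im z = 0")
    case True
    then have "exp (\<i> * z) = cis (Re z)"
      by (simp add: exp_eq_polar)
    then show ?thesis using that by auto
  qed (use E that in auto)
  have p_unit: "norm (p z) = 1" if "z \<in> ?S" "Im z = 0" for z
  proof -
    have "exp (\<i> * z) = cis (Re z)"
      using that by (simp add: exp_eq_polar)
    then show ?thesis using that unit by (simp add: p_def)
  qed
  have p_nz: "p z \<noteq> 0" if "z \<in> ?S" "0 \<le> Im z" for z
    using nz [OF E] p_unit [OF that(1)] that by (force simp: p_def less_le)
  have cp: "continuous_on (?S \<inter> {z. 0 \<le> Im z}) p"
    unfolding p_def
  proof (rule continuous_on_compose2 [OF cont])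
    show "(\<lambda>z. exp (\<i> * z)) ` (?S \<inter> {z. 0 \<le> Im z}) \<subseteq> ball 0 1 \<union> cis ` {a<..<b}"
      using E0 by blast
  qed (intro continuous_intros)
  have "(\<phi> \<circ> (\<lambda>z. exp (\<i> * z))) holomorphic_on ?S \<inter> {z. 0 < Im z}"
    by (rule holomorphic_on_compose_gen [OF _ hol]) (use E in \<open>auto intro!: holomorphic_intros\<close>)
  then have hp: "p holomorphic_on ?S \<inter> {z. 0 < Im z}"
    by (simp add: p_def [abs_def] o_def)
  have cq: "continuous_on (?S \<inter> {z. Im z \<le> 0}) (\<lambda>z. inverse (cnj (p (cnj z))))"
    by (intro continuous_intros continuous_on_compose2 [OF cp]) (use p_nz in auto)
  have "(cnj \<circ> (\<lambda>z. inverse (p z)) \<circ> cnj) holomorphic_on ?S \<inter> {z. Im z < 0}"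
  proof (rule holomorphic_on_compose_cnj_cnj)
    show "(\<lambda>z. inverse (p z)) holomorphic_on cnj ` (?S \<inter> {z. Im z < 0})"
      by (rule holomorphic_on_subset [of _ "?S \<inter> {z. 0 < Im z}"])
         (use p_nz in \<open>auto intro!: holomorphic_intros hp\<close>)
    show "open (?S \<inter> {z. Im z < 0})"
      by (intro open_Int S open_halfspace_Im_lt)
  qed
  then have hq: "(\<lambda>z. inverse (cnj (p (cnj z)))) holomorphic_on ?S \<inter> {z. Im z < 0}"
    by (simp add: o_def)
  define H where "H z = (if 0 \<le> Im z then p z else inverse (cnj (p (cnj z))))" for z
  \<comment> \<open>With normal \<open>- \<i>\<close> the inner product is \<open>- Im z\<close>, so
    the side \<open>< 0\<close> of the line is the upper half-plane.\<close>
  have "H holomorphic_on ?S"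
  proof (rule holomorphic_on_paste_across_line [OF S, of "- \<i>" _ 0])
    \<comment> \<open>On the real segment \<open>z\<close> is fixed by \<open>cnj\<close>, and
      \<open>p z\<close>, having modulus 1, is fixed by reflection in the unit circle; so the two
      branches match.\<close>
    have agree: "p z = inverse (cnj (p (cnj z)))" if "z \<in> ?S" "Im z = 0" for z
    proof -
      have "p z * cnj (p z) = 1"
        using p_unit [OF that] by (simp add: complex_norm_square [symmetric])
      moreover have "cnj z = z"
        using that by (simp add: complex_eq_iff)
      ultimately show ?thesis
        by (metis inverse_unique mult.commute)
    qed
    have un: "(?S \<inter> {z. 0 \<le> Im z}) \<union> (?S \<inter> {z. Im z \<le> 0}) = ?S"
      by auto
    have "continuous_on ((?S \<inter> {z. 0 \<le> Im z}) \<union> (?S \<inter> {z. Im z \<le> 0})) H"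
      unfolding H_def
    proof (rule continuous_on_cases_local, unfold un)
      show "closedin (top_of_set ?S) (?S \<inter> {z. 0 \<le> Im z})"
        by (rule closedin_closed_Int [OF closed_halfspace_Im_ge])
      show "closedin (top_of_set ?S) (?S \<inter> {z. Im z \<le> 0})"
        by (rule closedin_closed_Int [OF closed_halfspace_Im_le])
      show "p z = inverse (cnj (p (cnj z)))"
        if "z \<in> ?S \<inter> {z. 0 \<le> Im z} \<and> \<not> 0 \<le> Im z \<or> z \<in> ?S \<inter> {z. Im z \<le> 0} \<and> 0 \<le> Im z" for z
        by (rule agree) (use that in auto)
    qed (rule cp cq)+
    then show "continuous_on ?S H" by (simp only: un)
    have "H holomorphic_on ?S \<inter> {z. 0 < Im z}"
      by (rule holomorphic_transform [OF hp]) (simp add: H_def)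
    then show "H holomorphic_on ?S \<inter> {z. - \<i> \<bullet> z < 0}"
      by (simp add: inner_complex_def)
    have "H holomorphic_on ?S \<inter> {z. Im z < 0}"
      by (rule holomorphic_transform [OF hq]) (simp add: H_def)
    then show "H holomorphic_on ?S \<inter> {z. 0 < - \<i> \<bullet> z}"
      by (simp add: inner_complex_def)
  qed auto
  moreover have "H = ?H"
    by (simp add: fun_eq_iff H_def p_def)
  ultimately show ?thesis by simp
qed

section \<open>Diagonal limits and Schwarz estimates for the Riemann maps and their inverses\<close>

text \<open>Meant for compositions such as \<open>g n (f n w)\<close>, where both the map and the
  point move with \<open>n\<close>.\<close>

lemma uniform_limit_tendsto_diagonal:
  fixes F :: "nat \<Rightarrow> 'a :: metric_space \<Rightarrow> 'b :: metric_space"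
  assumes lim: "uniform_limit K F G sequentially" and G: "continuous_on K G"
    and x: "\<And>n. x n \<in> K" "x \<longlonglongrightarrow> l" "l \<in> K"
  shows "(\<lambda>n. F n (x n)) \<longlonglongrightarrow> G l"
proof -
  have Gx: "(\<lambda>n. G (x n)) \<longlonglongrightarrow> G l"
    by (rule continuous_on_tendsto_compose [OF G x(2,3)]) (simp add: x)
  show ?thesis
  proof (rule tendstoI)
    fix e :: real assume "e > 0"
    then have e: "e / 2 > 0" by simp
    show "\<forall>\<^sub>F n in sequentially. dist (F n (x n)) (G l) < e"
      using uniform_limitD [OF lim e] tendstoD [OF Gx e]
    proof eventually_elim
      case (elim n)
      then show ?case
        using x(1) by (meson dist_triangle_half_l dist_commute_lessI)
    qed
  qed
qed

text \<open>The growth bound is Schwarz' lemma for \<open>g / R\<close>, a self-map of the disc. At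
  \<open>w = f z\<close> it becomes \<open>norm z \<le> R * norm (f z)\<close>, a lower bound for
  \<open>f\<close> away from 0 that depends on \<open>D\<close> only through
  \<open>R\<close>.\<close>

lemma Riemann_map_inverse:
  assumes D: "ball 0 1 \<subseteq> D" "D \<subseteq> ball 0 R"
    and f: "Riemann_map D f" "f 0 = 0"
  obtains g where "g holomorphic_on ball 0 1" "g ` ball 0 1 = D"
    "\<And>z. z \<in> D \<Longrightarrow> g (f z) = z" "\<And>w. w \<in> ball 0 1 \<Longrightarrow> norm (g w) \<le> R * norm w"
proof
  define g where "g = inv_into D f"
  have bij: "bij_betw f D (ball 0 1)" and holg: "g holomorphic_on ball 0 1"
    using f(1) by (auto simp: biholomorphic_map_def g_def)
  show "g holomorphic_on ball 0 1" by fact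
  show im: "g ` ball 0 1 = D"
    using bij_betw_inv_into [OF bij] by (simp add: g_def bij_betw_def)
  show inv: "g (f z) = z" if "z \<in> D" for z
    using bij that by (simp add: g_def bij_betw_inv_into_left)
  have g0: "g 0 = 0"
    using inv [of 0] f(2) D(1) by (simp add: subset_iff)
  have R: "R > 0"
    using D(1,2) by (metis centre_in_ball order_trans subsetD zero_less_one)
  show "norm (g w) \<le> R * norm w" if "w \<in> ball 0 1" for w
  proof -
    have "norm (g w / R) \<le> norm w"
    proof (rule Schwarz_Lemma(1))
      show "(\<lambda>w. g w / R) holomorphic_on ball 0 1"
        using R by (intro holomorphic_intros holg) auto
      show "norm (g w / R) < 1" if "norm w < 1" for w
      proof -
        have "g w \<in> ball 0 R"
          using im D(2) that by force
        then show ?thesis using R by (simp add: norm_divide)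
      qed
    qed (use g0 that in auto)
    then show ?thesis
      using R by (simp add: norm_divide field_simps)
  qed
qed

lemma Riemann_map_Schwarz:
  assumes "ball 0 1 \<subseteq> D" "Riemann_map D f" "f 0 = 0" "norm z < 1"
  shows "norm (f z) \<le> norm z"
proof (rule Schwarz_Lemma(1))
  show "f holomorphic_on ball 0 1"
    using assms unfolding biholomorphic_map_def by (meson holomorphic_on_subset)
  show "norm (f z) < 1" if "norm z < 1" for z
    using assms(1,2) that unfolding biholomorphic_map_def bij_betw_def by fastforce
qed (use assms in auto)

section \<open>Convergence to the identity inside the disc\<close>

lemma Riemann_maps_tendsto_id_on_disc:
  fixes D :: "nat \<Rightarrow> complex set" and f :: "nat \<Rightarrow> complex \<Rightarrow> complex"
  assumes D: "\<And>j. ball 0 1 \<subseteq> D j" "\<And>j. D j \<subseteq> ball 0 R" "\<And>j. open (D j)"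
    and kernel: "kernel_converges 0 D (ball 0 1)"
    and f: "\<And>j. Riemann_map (D j) (f j)" "\<And>j. f j 0 = 0"
    and deriv: "\<And>j. deriv (f j) 0 \<in> \<real>" "\<And>j. Re (deriv (f j) 0) > 0"
    and K: "compact K" "K \<subseteq> ball 0 1"
  shows "uniform_limit K f id sequentially"
proof (rule uniform_limit_if_unique_subsequential_limit [of "ball 0 1" f 1])
  have holf: "f j holomorphic_on ball 0 1" for j
    using D(1) f(1) unfolding biholomorphic_map_def by (meson holomorphic_on_subset)
  then show "f j holomorphic_on ball 0 1" for j .
  have f_le: "norm (f j z) \<le> norm z" if "norm z < 1" for j z
    using Riemann_map_Schwarz [OF D(1) f(1) f(2)] that by blast
  then show "norm (f j z) \<le> 1" if "z \<in> ball 0 1" for j z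
    using that by (metis less_eq_real_def mem_ball_0 order_trans)
  have "\<exists>g. g holomorphic_on ball 0 1 \<and> g ` ball 0 1 = D j \<and>
          (\<forall>z \<in> D j. g (f j z) = z)" for j
    by (rule Riemann_map_inverse [OF D(1,2) f]) blast
  then obtain g where g: "\<And>j. g j holomorphic_on ball 0 1"
      "\<And>j. g j ` ball 0 1 = D j" "\<And>j z. z \<in> D j \<Longrightarrow> g j (f j z) = z"
    by metis
  fix h and r :: "nat \<Rightarrow> nat" and z :: complex
  assume r: "strict_mono r" and h: "h holomorphic_on ball 0 1"
    and lim: "\<And>L. \<lbrakk>compact L; L \<subseteq> ball 0 1\<rbrakk> \<Longrightarrow> uniform_limit L (\<lambda>n. f (r n)) h sequentially"
    and z: "z \<in> ball 0 1"
  have g_bdd: "\<exists>B. \<forall>k\<in>range g. \<forall>w\<in>L. norm (k w) \<le> B" if "L \<subseteq> ball 0 1" for L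
  proof (intro exI ballI)
    fix k w assume "k \<in> range g" "w \<in> L"
    then have "k w \<in> ball 0 R"
      using g(2) D(2) that by blast
    then show "norm (k w) \<le> R" by simp
  qed
  obtain G s where G: "G holomorphic_on ball 0 1" and s: "strict_mono (s :: nat \<Rightarrow> nat)"
    and limG: "\<And>L. \<lbrakk>compact L; L \<subseteq> ball 0 1\<rbrakk> \<Longrightarrow> uniform_limit L ((\<lambda>n. g (r n)) \<circ> s) G sequentially"
    by (rule Montel [of "ball 0 1" "range g" "\<lambda>n. g (r n)"]) (use g(1) g_bdd in blast)+
  define t where "t = r \<circ> s"
  have t: "strict_mono t"
    using r s by (simp add: t_def strict_mono_o)
  have limG: "uniform_limit L (\<lambda>n. g (t n)) G sequentially" if "compact L" "L \<subseteq> ball 0 1" for L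
    using limG [OF that] by (simp add: t_def o_def)
  have fh: "(\<lambda>n. f (r n) w) \<longlonglongrightarrow> h w" if "norm w < 1" for w
    using tendsto_uniform_limitI [OF lim [of "{w}"]] that by simp
  have h_le: "norm (h w) \<le> norm w" if "norm w < 1" for w
    by (rule LIMSEQ_le_const2 [OF tendsto_norm [OF fh [OF that]]]) (use f_le that in blast)
  \<comment> \<open>By \<open>f_le\<close> and \<open>h_le\<close> the points
    \<open>f (t n) w\<close> and their limit stay in one compact disc on which
    \<open>g (t n)\<close> converges uniformly, so the inverse relation passes to the limit.\<close>
  have Gh: "G (h w) = w" if "norm w < 1" for w
  proof -
    let ?L = "cball (0 :: complex) (norm w)"
    have L: "compact ?L" "?L \<subseteq> ball 0 1" using that by auto
    have "(\<lambda>n. g (t n) (f (t n) w)) \<longlonglongrightarrow> G (h w)"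
    proof (rule uniform_limit_tendsto_diagonal [OF limG [OF L]])
      show "continuous_on ?L G"
        using G L(2) by (meson holomorphic_on_imp_continuous_on holomorphic_on_subset)
      show "(\<lambda>n. f (t n) w) \<longlonglongrightarrow> h w"
        using LIMSEQ_subseq_LIMSEQ [OF fh [OF that] s] by (simp add: t_def o_def)
    qed (use f_le h_le that in auto)
    moreover have "g (t n) (f (t n) w) = w" for n
      using g(3) D(1) that by (metis mem_ball_0 subsetD)
    ultimately show ?thesis
      by (simp add: LIMSEQ_const_iff)
  qed
  have h0: "h 0 = 0" and G0: "G 0 = 0"
    using h_le [of 0] Gh [of 0] by auto
  \<comment> \<open>Since \<open>G\<close> undoes \<open>h\<close>, it takes different values at 0
    and at \<open>h (1/2)\<close>.\<close>
  have nonconst: "\<not> G constant_on ball 0 1"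
  proof
    assume "G constant_on ball 0 1"
    moreover have "h (1/2) \<in> ball 0 1"
      using h_le [of "1/2"] by simp
    ultimately have "G (h (1/2)) = G 0"
      unfolding constant_on_def by (metis centre_in_ball zero_less_one)
    then show False using Gh [of "1/2"] G0 by simp
  qed
  \<comment> \<open>Hurwitz puts each compact subset of the image of \<open>G\<close> into
    \<open>D (t n)\<close>, the image of \<open>g (t n)\<close>, from some index on. Hence the
    kernel of this subsequence, the unit disc, contains the image of \<open>G\<close>.\<close>
  have "kernel_admissible 0 (D \<circ> t) (G ` ball 0 1)"
    unfolding kernel_admissible_def domain_in_plane_def
  proof (intro conjI allI impI)
    show "open (G ` ball 0 1)"
      by (rule open_mapping_thm [OF G]) (use nonconst in auto)
    show "connected (G ` ball 0 1)"
      by (intro connected_continuous_image holomorphic_on_imp_continuous_on G connected_ball)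
    show "0 \<in> G ` ball 0 1"
      using G0 by (metis centre_in_ball image_eqI zero_less_one)
    show "\<forall>\<^sub>F j in sequentially. L \<subseteq> (D \<circ> t) j" if "compact L \<and> L \<subseteq> G ` ball 0 1" for L
      using compact_eventually_subset_image [of "ball 0 1" "\<lambda>n. g (t n)" G L]
        g(1,2) G limG nonconst that by auto
  qed auto
  then have "G ` ball 0 1 \<subseteq> ball 0 1"
    using kernel t unfolding kernel_converges_def is_kernel_def by blast
  then have G_le: "norm (G w) \<le> norm w" if "norm w < 1" for w
    using Schwarz_Lemma(1) [OF G G0 _ that] by (force simp: image_subset_iff)
  \<comment> \<open>Equality case of Schwarz' lemma, tested at one nonzero point:
    \<open>1/2 = norm (G (h (1/2))) \<le> norm (h (1/2)) \<le> 1/2\<close>.\<close>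
  have "norm (h (1/2)) = norm (1/2 :: complex)"
    using h_le [of "1/2"] G_le [of "h (1/2)"] Gh [of "1/2"] by simp
  moreover have "norm (h w) < 1" if "norm w < 1" for w
    using h_le [OF that] that by simp
  ultimately have "\<exists>\<alpha>. (\<forall>w. norm w < 1 \<longrightarrow> h w = \<alpha> * w) \<and> norm \<alpha> = 1"
    by (intro Schwarz_Lemma(3) [OF h h0, of 0] disjI1 exI [of _ "1/2"]) auto
  then obtain \<alpha> where \<alpha>: "\<And>w. norm w < 1 \<Longrightarrow> h w = \<alpha> * w" "norm \<alpha> = 1"
    by blast
  have "deriv h 0 = \<alpha>"
  proof (rule DERIV_imp_deriv)
    have "((\<lambda>w. \<alpha> * w) has_field_derivative \<alpha>) (at 0)"
      by (auto intro!: derivative_eq_intros)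
    then show "(h has_field_derivative \<alpha>) (at 0)"
      by (rule has_field_derivative_transform_within_open [of _ _ _ "ball 0 1"]) (auto simp: \<alpha>)
  qed
  moreover have "(\<lambda>n. deriv (f (r n)) 0) \<longlonglongrightarrow> deriv h 0"
  proof (rule deriv_complex_uniform_limit [where A = "ball 0 (1/2)"])
    show "uniform_limit (ball 0 (1/2)) (\<lambda>n. f (r n)) h sequentially"
      by (rule uniform_limit_on_subset [OF lim [of "cball 0 (1/2)"]]) auto
    show "\<forall>\<^sub>F n in sequentially. f (r n) holomorphic_on ball 0 (1/2)"
      by (intro always_eventually allI holomorphic_on_subset [OF holf]) auto
  qed auto
  ultimately have lim\<alpha>: "(\<lambda>n. deriv (f (r n)) 0) \<longlonglongrightarrow> \<alpha>" by simp
  \<comment> \<open>Positivity survives the limit only as \<open>Re \<alpha> \<ge> 0\<close>, but a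
    real number of modulus 1 with nonnegative real part is 1.\<close>
  have "Re \<alpha> \<ge> 0"
    by (rule LIMSEQ_le_const [OF tendsto_Re [OF lim\<alpha>]]) (use deriv(2) less_imp_le in blast)
  moreover have "\<alpha> \<in> \<real>"
    by (rule Lim_in_closed_set [OF closed_complex_Reals _ _ lim\<alpha>]) (use deriv(1) in auto)
  ultimately have "\<alpha> = 1"
    using \<alpha>(2) by (auto elim!: Reals_cases)
  then show "h z = id z"
    using \<alpha>(1) z by simp
qed (use K in auto)

section \<open>Convergence near a point of the arc\<close>

lemma uniform_limit_compact_local:
  fixes K :: "'a :: topological_space set"
  assumes K: "compact K"
    and loc: "\<And>z. z \<in> K \<Longrightarrow> \<exists>N. open N \<and> z \<in> N \<and> uniform_limit (N \<inter> K) f g F"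
  shows "uniform_limit K f g F"
proof -
  define \<C> where "\<C> = {N. open N \<and> uniform_limit (N \<inter> K) f g F}"
  have "K \<subseteq> \<Union>\<C>" and "\<And>N. N \<in> \<C> \<Longrightarrow> open N"
    using loc by (auto simp: \<C>_def)
  then obtain \<D> where \<D>: "\<D> \<subseteq> \<C>" "finite \<D>" "K \<subseteq> \<Union>\<D>"
    by (rule compactE [OF K])
  have "uniform_limit (\<Union>N\<in>\<D>. N \<inter> K) f g F"
    by (rule uniform_limit_on_UNION) (use \<D> in \<open>auto simp: \<C>_def\<close>)
  then show ?thesis
    by (rule uniform_limit_on_subset) (use \<D> in blast)
qed

lemma open_image_exp_i:
  assumes "open A"
  shows "open ((\<lambda>z. exp (\<i> * z)) ` A)"
proof (rule open_mapping_thm [of _ UNIV])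
  show "\<not> (\<lambda>z. exp (\<i> * z)) constant_on UNIV"
  proof
    assume "(\<lambda>z. exp (\<i> * z)) constant_on UNIV"
    then have "exp (\<i> * 0) = exp (\<i> * of_real pi)"
      unfolding constant_on_def by (metis UNIV_I)
    then show False by (simp add: exp_eq_polar)
  qed
qed (use assms in \<open>auto intro!: holomorphic_intros\<close>)

text \<open>After reflection the maps are holomorphic on a full neighbourhood of
  \<open>\<theta>\<close>, with a bound independent of \<open>j\<close>. Pointwise convergence in
  the open disc then determines every subsequential limit up to and across the arc.\<close>

lemma uniform_limit_id_near_arc:
  fixes f :: "nat \<Rightarrow> complex \<Rightarrow> complex"
  assumes hol: "\<And>j. f j holomorphic_on ball 0 1"
    and cont: "\<And>j. continuous_on (ball 0 1 \<union> cis ` {a<..<b}) (f j)"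
    and le: "\<And>j z. norm z < 1 \<Longrightarrow> norm (f j z) \<le> 1"
    and ge: "\<And>j z. norm z < 1 \<Longrightarrow> norm z \<le> R * norm (f j z)"
    and unit: "\<And>j t. t \<in> {a<..<b} \<Longrightarrow> norm (f j (cis t)) = 1"
    and lim: "\<And>z. norm z < 1 \<Longrightarrow> (\<lambda>j. f j z) \<longlonglongrightarrow> z"
    and \<theta>: "\<theta> \<in> {a<..<b}"
  obtains N where "open N" "cis \<theta> \<in> N" "uniform_limit (N \<inter> cball 0 1) f id sequentially"
proof -
  \<comment> \<open>The reflected branch evaluates \<open>f j\<close> at a point of modulus
    \<open>exp (Im z)\<close>. The cut at height -1 keeps this above \<open>exp (-1)\<close>, away
    from 0, where \<open>ge\<close> gives no lower bound.\<close>
  define S where "S = {z. a < Re z \<and> Re z < b} \<inter> {z. -1 < Im z}"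
  define H where "H j z = (if 0 \<le> Im z then f j (exp (\<i> * z))
                            else inverse (cnj (f j (exp (\<i> * cnj z)))))" for j z
  have S: "open S" "convex S"
    unfolding S_def
    by (intro open_Int open_Collect_conj open_Collect_less continuous_intros)
       (auto simp: Collect_conj_eq intro!: convex_Int convex_halfspace_Re_gt convex_halfspace_Re_lt convex_halfspace_Im_gt)
  have nz: "f j z \<noteq> 0" if "norm z < 1" "z \<noteq> 0" for j z
    using ge [OF that(1), of j] that(2) by auto
  have holH: "H j holomorphic_on S" for j
  proof -
    have "H j holomorphic_on {z. a < Re z \<and> Re z < b}"
      unfolding H_def by (rule holomorphic_circle_reflection) (use hol cont nz unit in auto)
    then show ?thesis
      by (rule holomorphic_on_subset) (auto simp: S_def)
  qed
  have real: "exp (\<i> * z) = cis (Re z)" if "Im z = 0" for z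
    using that by (simp add: exp_eq_polar)
  \<comment> \<open>The value 1 serves the closed upper half; \<open>R * exp 1\<close> comes from
    inverting \<open>exp (-1) \<le> R * norm (f j w)\<close> on the reflected half.\<close>
  have H_le: "norm (H j z) \<le> max 1 (R * exp 1)" if z: "z \<in> S" for j z
  proof -
    consider "Im z > 0" | "Im z = 0" | "Im z < 0" by linarith
    then show ?thesis
    proof cases
      case 1
      then show ?thesis using le [of "exp (\<i> * z)" j] by (simp add: H_def)
    next
      case 2
      then show ?thesis using unit [of "Re z" j] z real [OF 2] by (simp add: H_def S_def)
    next
      case 3
      define w where "w = exp (\<i> * cnj z)"
      have w: "norm w < 1" "exp (-1) < norm w"
        using 3 z by (simp_all add: w_def S_def)
      have "w \<noteq> 0" by (simp add: w_def)
      then have pos: "0 < norm (f j w)"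
        using nz w by simp
      have "exp (-1) \<le> R * norm (f j w)"
        using ge [OF w(1), of j] w(2) by linarith
      then have "exp 1 * exp (-1) \<le> exp 1 * (R * norm (f j w))"
        by (intro mult_left_mono) auto
      then have "1 \<le> R * exp 1 * norm (f j w)"
        by (simp add: exp_minus mult_ac)
      then have "inverse (norm (f j w)) \<le> R * exp 1"
        using pos by (simp add: field_simps)
      moreover have "norm (H j z) = inverse (norm (f j w))"
        using 3 by (simp add: H_def w_def norm_inverse)
      ultimately show ?thesis by simp
    qed
  qed
  have limH: "uniform_limit L H (\<lambda>z. exp (\<i> * z)) sequentially" if L: "compact L" "L \<subseteq> S" for L
  proof (rule uniform_limit_if_unique_subsequential_limit [OF S(1) holH H_le _ L])
    fix h and r :: "nat \<Rightarrow> nat" and z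
    assume r: "strict_mono r" and h: "h holomorphic_on S" and z: "z \<in> S"
      and limh: "\<And>L. \<lbrakk>compact L; L \<subseteq> S\<rbrakk> \<Longrightarrow> uniform_limit L (\<lambda>n. H (r n)) h sequentially"
    \<comment> \<open>Identity theorem: in the upper half \<open>H\<close> is \<open>f\<close> at a
      point of the open disc, where \<open>lim\<close> gives the limit; connectedness of
      \<open>S\<close> carries the equality across the real axis.\<close>
    show "h z = exp (\<i> * z)"
    proof (rule analytic_continuation_open [of "S \<inter> {z. 0 < Im z}" S h])
      show "open (S \<inter> {z. 0 < Im z})"
        by (intro open_Int S open_halfspace_Im_gt)
      have "Complex ((a + b) / 2) 1 \<in> S \<inter> {z. 0 < Im z}"
        using \<theta> by (auto simp: S_def)
      then show "S \<inter> {z. 0 < Im z} \<noteq> {}" by blast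
      show "h w = exp (\<i> * w)" if w: "w \<in> S \<inter> {z. 0 < Im z}" for w
      proof (rule LIMSEQ_unique)
        show "(\<lambda>n. H (r n) w) \<longlonglongrightarrow> h w"
          using tendsto_uniform_limitI [OF limh [of "{w}"]] w by simp
        have "(\<lambda>n. f (r n) (exp (\<i> * w))) \<longlonglongrightarrow> exp (\<i> * w)"
          using LIMSEQ_subseq_LIMSEQ [OF lim r, of "exp (\<i> * w)"] w by (simp add: o_def)
        then show "(\<lambda>n. H (r n) w) \<longlonglongrightarrow> exp (\<i> * w)"
          using w by (simp add: H_def)
      qed
    qed (use S h z in \<open>auto intro!: holomorphic_intros convex_connected\<close>)
  qed
  have "of_real \<theta> \<in> S"
    using \<theta> by (simp add: S_def)
  then obtain e where e: "e > 0" "cball (of_real \<theta>) e \<subseteq> S"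
    using S(1) open_contains_cball by blast
  \<comment> \<open>The exponential is an open map, so this image is a neighbourhood of
    \<open>cis \<theta>\<close> and no branch of the logarithm has to be chosen.\<close>
  define N where "N = (\<lambda>z. exp (\<i> * z)) ` ball (of_real \<theta>) e"
  show ?thesis
  proof
    show "open N"
      unfolding N_def by (intro open_image_exp_i open_ball)
    show "cis \<theta> \<in> N"
      unfolding N_def using e(1) real [of "of_real \<theta>"] by (intro image_eqI [of _ _ "of_real \<theta>"]) auto
    show "uniform_limit (N \<inter> cball 0 1) f id sequentially"
    proof (rule uniform_limitI)
      fix d :: real assume "d > 0"
      show "\<forall>\<^sub>F n in sequentially. \<forall>w\<in>N \<inter> cball 0 1. dist (f n w) (id w) < d"
        using uniform_limitD [OF limH [OF compact_cball e(2)] \<open>d > 0\<close>]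
      proof eventually_elim
        case (elim n)
        show ?case
        proof
          fix w assume "w \<in> N \<inter> cball 0 1"
          then obtain z where "z \<in> ball (of_real \<theta>) e" "w = exp (\<i> * z)" "norm w \<le> 1"
            unfolding N_def by (metis IntE imageE mem_cball_0)
          then have z: "z \<in> cball (of_real \<theta>) e" "w = exp (\<i> * z)" "norm w \<le> 1"
            by auto
          \<comment> \<open>Restricting to the closed disc leaves only the first branch of
            \<open>H\<close>, where \<open>H n z = f n w\<close>.\<close>
          then have "0 \<le> Im z" by simp
          with elim z show "dist (f n w) (id w) < d"
            by (force simp: H_def)
        qed
      qed
    qed
  qed
qed

section \<open>Combining the disc and the arc\<close>

theorem theorem1p1:
  fixes \<Gamma> U :: "complex set" and D :: "nat \<Rightarrow> complex set"
    and R :: real and f :: "nat \<Rightarrow> complex \<Rightarrow> complex"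
  assumes "open_circle_arc \<Gamma>"
    and "open U" and "closure \<Gamma> \<subseteq> U"
    and "\<And>j. domain_in_plane (D j)" and "\<And>j. simply_connected (D j)"
    and "\<And>j. ball 0 1 \<subseteq> D j"
    and "\<And>j. bounded_by_Jordan_curve (D j)"
    and "R > 0" and "\<And>j. D j \<subseteq> ball 0 R"
    and "\<And>j. D j \<inter> U = ball 0 1 \<inter> U"
    and "kernel_converges 0 D (ball 0 1)"
    and "\<And>j. Riemann_map (D j) (f j)"
    and "\<And>j. f j 0 = 0"
    and "\<And>j. deriv (f j) 0 \<in> \<real>" and "\<And>j. Re (deriv (f j) 0) > 0"
    and "\<And>j. continuous_on (closure (D j)) (f j)"
  shows "\<forall>K. compact K \<and> K \<subseteq> ball 0 1 \<union> \<Gamma> \<longrightarrow> uniform_limit K f id sequentially"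
proof (intro allI impI)
  fix K assume K: "compact K \<and> K \<subseteq> ball 0 1 \<union> \<Gamma>"
  obtain a b where \<Gamma>: "\<Gamma> = cis ` {a<..<b}"
    using assms(1) by (auto simp: open_circle_arc_def)
  have op: "open (D j)" for j
    using assms(4) by (simp add: domain_in_plane_def)
  have disc: "uniform_limit L f id sequentially" if "compact L" "L \<subseteq> ball 0 1" for L
    by (rule Riemann_maps_tendsto_id_on_disc [of D R]) (rule assms op that)+
  \<comment> \<open>Arc points lie in \<open>U\<close>, where \<open>D j\<close> agrees with the
    open disc, but have modulus 1. Together with \<open>clD\<close> this puts the arc on the
    frontier of every \<open>D j\<close>, so that \<open>norm_eq_1_on_frontier\<close>
    applies.\<close>
  have \<Gamma>D: "z \<notin> D j" if "z \<in> \<Gamma>" for z j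
  proof
    assume "z \<in> D j"
    moreover have "z \<in> U"
      using that assms(3) closure_subset by blast
    ultimately have "z \<in> ball 0 1"
      using assms(10) by blast
    then show False using that by (auto simp: \<Gamma>)
  qed
  have clD: "cball 0 1 \<subseteq> closure (D j)" for j
    using closure_mono [OF assms(6)] by simp
  have \<Gamma>_sphere: "\<Gamma> \<subseteq> cball 0 1"
    by (auto simp: \<Gamma>)
  have near_arc: "\<exists>N. open N \<and> cis \<theta> \<in> N \<and> uniform_limit (N \<inter> cball 0 1) f id sequentially"
    if \<theta>: "\<theta> \<in> {a<..<b}" for \<theta>
  proof (rule uniform_limit_id_near_arc [of f a b R])
    show "f j holomorphic_on ball 0 1" for j
      using assms(6,12) unfolding biholomorphic_map_def by (meson holomorphic_on_subset)
    show "continuous_on (ball 0 1 \<union> cis ` {a<..<b}) (f j)" for j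
      by (rule continuous_on_subset [OF assms(16)])
         (use clD \<Gamma>_sphere ball_subset_cball in \<open>unfold \<Gamma>, blast\<close>)
    show "norm (f j z) \<le> 1" if "norm z < 1" for j z
      using Riemann_map_Schwarz [OF assms(6,12,13) that] that by (meson less_imp_le order_trans)
    show "norm z \<le> R * norm (f j z)" if "norm z < 1" for j z
    proof (rule Riemann_map_inverse [OF assms(6,9,12,13)])
      fix g assume g: "\<And>z. z \<in> D j \<Longrightarrow> g (f j z) = z"
        "\<And>w. w \<in> ball 0 1 \<Longrightarrow> norm (g w) \<le> R * norm w"
      have "f j z \<in> ball 0 1"
        using Riemann_map_Schwarz [OF assms(6,12,13) that, of j] that by simp
      from g(2) [OF this] show ?thesis
        using g(1) assms(6) that by (metis mem_ball_0 subsetD)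
    qed
    show "norm (f j (cis t)) = 1" if "t \<in> {a<..<b}" for j t
    proof (rule norm_eq_1_on_frontier [OF op assms(12,16)])
      have "cis t \<in> \<Gamma>" using that by (simp add: \<Gamma>)
      then show "cis t \<in> closure (D j)" "cis t \<notin> D j"
        using clD \<Gamma>_sphere \<Gamma>D by blast+
    qed
    show "(\<lambda>j. f j z) \<longlonglongrightarrow> z" if "norm z < 1" for z
      using disc [of "{z}"] that by simp
  qed (use \<theta> in blast)+
  show "uniform_limit K f id sequentially"
  proof (rule uniform_limit_compact_local)
    fix z assume "z \<in> K"
    \<comment> \<open>Inside, a concentric disc of radius \<open>\<rho> < 1\<close> has compact
      closure in the unit disc; on the arc, \<open>near_arc\<close> suffices because
      \<open>K\<close> lies in the closed disc.\<close>
    then consider "norm z < 1" | \<theta> where "\<theta> \<in> {a<..<b}" "z = cis \<theta>"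
      using K by (auto simp: \<Gamma>)
    then show "\<exists>N. open N \<and> z \<in> N \<and> uniform_limit (N \<inter> K) f id sequentially"
    proof cases
      case 1
      then obtain \<rho> where \<rho>: "norm z < \<rho>" "\<rho> < 1"
        using dense by blast
      have "uniform_limit (ball 0 \<rho> \<inter> K) f id sequentially"
        by (rule uniform_limit_on_subset [OF disc [of "cball 0 \<rho>"]]) (use \<rho> in auto)
      then show ?thesis using \<rho> by (intro exI [of _ "ball 0 \<rho>"]) auto
    next
      case 2
      obtain N where N: "open N" "z \<in> N" "uniform_limit (N \<inter> cball 0 1) f id sequentially"
        using near_arc [OF 2(1)] 2(2) by blast
      have "N \<inter> K \<subseteq> N \<inter> cball 0 1"
        using K \<Gamma>_sphere ball_subset_cball by blast
      from uniform_limit_on_subset [OF N(3) this] N(1,2) show ?thesis by blast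
    qed
  qed (use K in blast)
qed

end
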